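(* Let $v\in L^{2}(\mathbb{R})$ be a positive smooth function. Then there exist smooth real-valued functions $a$ and $b$ on $\mathbb{R}$ such that, for the operator $\mathrm{L}_{00}u=-u''+au'+bu$, $u\in C^{\infty}_{comp}(\mathbb{R})$, in $L^2(\mathbb{R})$ and its closure $\mathrm{L}_0$: (i) the operator $\mathrm{L}_{00}$ (and hence $\mathrm{L}_0$) is accretive; (ii) the operator $\mathrm{L}_0$ is not $m$-accretive, because $\mathrm{L}_0^{*}v+v=0$ (that is, $v\in\mathrm{Dom}(\mathrm{L}_0^* )$ and $\mathrm{L}_0^{*}v=-v$).
   Context: $L^2(\mathbb{R})$ is the complex Hilbert space with $(f,g)=\int_{\mathbb{R}} f\overline{g}\,dx$; $C^{\infty}_{comp}(\mathbb{R})$ is the set of (complex-valued) infinitely smooth compactly supported functions. A linear operator $\mathrm{A}$ in a Hilbert space is accretive if $\mathrm{Re}(\mathrm{A}x,x)\ge 0$ for all $x\in\mathrm{Dom}(\mathrm{A})$; an accretive operator $\mathrm{A}$ is $m$-accretive if the open left half-plane $\{\mathrm{Re}\,\lambda<0\}$ is contained in its resolvent set $\rho(\mathrm{A})$. $\mathrm{L}_0^*$ denotes the Hilbert space adjoint of $\mathrm{L}_0$. *)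

theory Defs
  imports "HOL-Analysis.Analysis"
begin

section \<open>The complex Hilbert space of square-integrable functions on the line\<close>

text \<open>
  Every Lebesgue measurable function agrees almost everywhere with a Borel measurable one, so
  Borel functions suffice as representatives.
\<close>

definition square_integrable :: "(real \<Rightarrow> complex) \<Rightarrow> bool" where
  "square_integrable f \<longleftrightarrow>
     f \<in> borel_measurable lborel \<and> integrable lborel (\<lambda>x. (cmod (f x))\<^sup>2)"

definition L2_rel :: "(real \<Rightarrow> complex) \<Rightarrow> (real \<Rightarrow> complex) \<Rightarrow> bool" where
  "L2_rel f g \<longleftrightarrow>
     square_integrable f \<and> square_integrable g \<and> (AE x in lborel. f x = g x)"

lemma square_integrable_zero: "square_integrable (\<lambda>x. 0)"
  by (simp add: square_integrable_def)

lemma L2_rel_part_equivp: "part_equivp L2_rel"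
proof (rule part_equivpI)
  show "\<exists>f. L2_rel f f"
    using square_integrable_zero by (auto simp: L2_rel_def)
  show "symp L2_rel"
    by (rule sympI) (auto simp: L2_rel_def elim: eventually_mono)
  show "transp L2_rel"
    by (rule transpI) (auto simp: L2_rel_def elim: eventually_elim2)
qed

quotient_type L2 = "real \<Rightarrow> complex" / partial: L2_rel
  morphisms rep_L2 to_L2
  by (rule L2_rel_part_equivp)

lemma square_integrable_mult_cnj:
  assumes "square_integrable f" "square_integrable g"
  shows "integrable lborel (\<lambda>x. f x * cnj (g x))"
proof (rule Bochner_Integration.integrable_bound)
  show "integrable lborel (\<lambda>x. (cmod (f x))\<^sup>2 + (cmod (g x))\<^sup>2)"
    using assms by (simp add: square_integrable_def)
  show "(\<lambda>x. f x * cnj (g x)) \<in> borel_measurable lborel"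
    using assms by (auto simp: square_integrable_def intro!: borel_measurable_times
        intro: borel_measurable_continuous_on[of cnj] continuous_intros)
  have "norm (z * cnj w) \<le> norm ((cmod z)\<^sup>2 + (cmod w)\<^sup>2)" for z w
  proof -
    have "2 * cmod z * cmod w \<le> (cmod z)\<^sup>2 + (cmod w)\<^sup>2"
      by (rule sum_squares_bound)
    moreover have "0 \<le> cmod z * cmod w" by simp
    ultimately have "cmod z * cmod w \<le> (cmod z)\<^sup>2 + (cmod w)\<^sup>2" by linarith
    then show ?thesis by (simp add: norm_mult)
  qed
  then show "AE x in lborel. norm (f x * cnj (g x)) \<le> norm ((cmod (f x))\<^sup>2 + (cmod (g x))\<^sup>2)"
    by simp
qed

lemma square_integrable_add:
  assumes "square_integrable f" "square_integrable g"
  shows "square_integrable (\<lambda>x. f x + g x)"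
  unfolding square_integrable_def
proof
  show m: "(\<lambda>x. f x + g x) \<in> borel_measurable lborel"
    using assms by (auto simp: square_integrable_def)
  show "integrable lborel (\<lambda>x. (cmod (f x + g x))\<^sup>2)"
  proof (rule Bochner_Integration.integrable_bound)
    show "integrable lborel (\<lambda>x. 2 * (cmod (f x))\<^sup>2 + 2 * (cmod (g x))\<^sup>2)"
      using assms by (simp add: square_integrable_def)
    show "(\<lambda>x. (cmod (f x + g x))\<^sup>2) \<in> borel_measurable lborel"
      using m by measurable
    have "norm ((cmod (z + w))\<^sup>2) \<le> norm (2 * (cmod z)\<^sup>2 + 2 * (cmod w)\<^sup>2)" for z w
    proof -
      have "(cmod (z + w))\<^sup>2 \<le> (cmod z + cmod w)\<^sup>2"
        by (intro power_mono norm_triangle_ineq) simp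
      also have "\<dots> \<le> 2 * (cmod z)\<^sup>2 + 2 * (cmod w)\<^sup>2"
        using sum_squares_bound[of "cmod z" "cmod w"] by (simp add: power2_sum)
      finally show ?thesis by simp
    qed
    then show "AE x in lborel. norm ((cmod (f x + g x))\<^sup>2)
        \<le> norm (2 * (cmod (f x))\<^sup>2 + 2 * (cmod (g x))\<^sup>2)"
      by simp
  qed
qed

lemma square_integrable_mult:
  assumes "square_integrable f"
  shows "square_integrable (\<lambda>x. c * f x)"
  using assms by (auto simp: square_integrable_def norm_mult power_mult_distrib)

lemma square_integrable_uminus:
  "square_integrable f \<Longrightarrow> square_integrable (\<lambda>x. - f x)"
  using square_integrable_mult[of f "-1"] by simp

lemma square_integrable_diff:
  "square_integrable f \<Longrightarrow> square_integrable g \<Longrightarrow> square_integrable (\<lambda>x. f x - g x)"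
  using square_integrable_add[of f "\<lambda>x. - g x"] square_integrable_uminus[of g] by simp

lift_definition cinner :: "L2 \<Rightarrow> L2 \<Rightarrow> complex"
  is "\<lambda>f g. \<integral>x. f x * cnj (g x) \<partial>lborel"
proof -
  fix f f' g g' assume *: "L2_rel f f'" "L2_rel g g'"
  show "(\<integral>x. f x * cnj (g x) \<partial>lborel) = (\<integral>x. f' x * cnj (g' x) \<partial>lborel)"
  proof (rule integral_cong_AE)
    show "(\<lambda>x. f x * cnj (g x)) \<in> borel_measurable lborel"
      "(\<lambda>x. f' x * cnj (g' x)) \<in> borel_measurable lborel"
      using * by (auto simp only: L2_rel_def intro!: borel_measurable_integrable
          square_integrable_mult_cnj)
    show "AE x in lborel. f x * cnj (g x) = f' x * cnj (g' x)"
      using * by (auto simp: L2_rel_def elim: eventually_elim2)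
  qed
qed

lift_definition scaleC :: "complex \<Rightarrow> L2 \<Rightarrow> L2" (infixr "*\<^sub>C" 75)
  is "\<lambda>c f x. c * f x"
  by (auto simp: L2_rel_def square_integrable_mult elim: eventually_mono)

text \<open>
  The norm and topology are those of the real inner product \<open>Re (cinner f g)\<close>, which induces the
  same norm as \<open>cinner\<close>.
\<close>

instantiation L2 :: real_inner
begin

lift_definition zero_L2 :: L2 is "\<lambda>x. 0"
  by (simp add: L2_rel_def square_integrable_zero)

lift_definition plus_L2 :: "L2 \<Rightarrow> L2 \<Rightarrow> L2" is "\<lambda>f g x. f x + g x"
  by (auto simp: L2_rel_def square_integrable_add elim: eventually_elim2)

lift_definition minus_L2 :: "L2 \<Rightarrow> L2 \<Rightarrow> L2" is "\<lambda>f g x. f x - g x"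
  by (auto simp: L2_rel_def square_integrable_diff elim: eventually_elim2)

lift_definition uminus_L2 :: "L2 \<Rightarrow> L2" is "\<lambda>f x. - f x"
  by (auto simp: L2_rel_def square_integrable_uminus elim: eventually_mono)

definition scaleR_L2 :: "real \<Rightarrow> L2 \<Rightarrow> L2" where
  "scaleR_L2 r f = complex_of_real r *\<^sub>C f"

definition inner_L2 :: "L2 \<Rightarrow> L2 \<Rightarrow> real" where
  "inner_L2 f g = Re (cinner f g)"

definition norm_L2 :: "L2 \<Rightarrow> real" where
  "norm_L2 f = sqrt (inner f f)"

definition sgn_L2 :: "L2 \<Rightarrow> L2" where
  "sgn_L2 f = scaleR (inverse (norm f)) f"

definition dist_L2 :: "L2 \<Rightarrow> L2 \<Rightarrow> real" where
  "dist_L2 f g = norm (f - g)"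

definition uniformity_L2 :: "(L2 \<times> L2) filter" where
  "uniformity_L2 = (INF e\<in>{0<..}. principal {(f, g). dist f g < e})"

definition open_L2 :: "L2 set \<Rightarrow> bool" where
  "open_L2 U \<longleftrightarrow> (\<forall>f\<in>U. eventually (\<lambda>(f', g). f' = f \<longrightarrow> g \<in> U) uniformity)"

instance
proof
  fix f g h :: L2 and r s :: real
  show "f + g + h = f + (g + h)"
    by transfer (auto simp: L2_rel_def square_integrable_add add.assoc)
  show "f + g = g + f"
    by transfer (auto simp: L2_rel_def square_integrable_add add.commute)
  show "0 + f = f"
    by transfer (auto simp: L2_rel_def)
  show "- f + f = 0"
    by transfer (auto simp: L2_rel_def square_integrable_zero)
  show "f - g = f + - g"
    by transfer (auto simp: L2_rel_def square_integrable_diff)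
  show "r *\<^sub>R (f + g) = r *\<^sub>R f + r *\<^sub>R g"
    unfolding scaleR_L2_def by transfer (auto simp: L2_rel_def distrib_left
        intro!: square_integrable_add square_integrable_mult)
  show "(r + s) *\<^sub>R f = r *\<^sub>R f + s *\<^sub>R f"
    unfolding scaleR_L2_def by transfer (auto simp: L2_rel_def distrib_right
        intro!: square_integrable_add square_integrable_mult)
  show "r *\<^sub>R s *\<^sub>R f = (r * s) *\<^sub>R f"
    unfolding scaleR_L2_def by transfer (auto simp: L2_rel_def mult.assoc
        intro!: square_integrable_mult)
  show "1 *\<^sub>R f = f"
    unfolding scaleR_L2_def by transfer (auto simp: L2_rel_def)
  show "dist f g = norm (f - g)" by (rule dist_L2_def)
  show "sgn f = inverse (norm f) *\<^sub>R f" by (rule sgn_L2_def)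
  show "(uniformity :: (L2 \<times> L2) filter) = (INF e\<in>{0<..}. principal {(f, g). dist f g < e})"
    by (rule uniformity_L2_def)
  show "open U \<longleftrightarrow> (\<forall>f\<in>U. eventually (\<lambda>(f', g). f' = f \<longrightarrow> g \<in> U) uniformity)"
    for U :: "L2 set"
    by (rule open_L2_def)
  show "inner f g = inner g f"
    unfolding inner_L2_def
  proof transfer
    fix f g assume "L2_rel f f" "L2_rel g g"
    have "(\<integral>x. g x * cnj (f x) \<partial>lborel) = (\<integral>x. cnj (f x * cnj (g x)) \<partial>lborel)"
      by (simp add: mult.commute)
    also have "\<dots> = cnj (\<integral>x. f x * cnj (g x) \<partial>lborel)"
      by (rule Bochner_Integration.integral_cnj)
    finally show "Re (\<integral>x. f x * cnj (g x) \<partial>lborel) = Re (\<integral>x. g x * cnj (f x) \<partial>lborel)"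
      by simp
  qed
  show "inner (f + g) h = inner f h + inner g h"
    unfolding inner_L2_def
    by transfer (auto simp: L2_rel_def distrib_right square_integrable_mult_cnj
        Bochner_Integration.integral_add)
  show "inner (r *\<^sub>R f) g = r * inner f g"
    unfolding inner_L2_def scaleR_L2_def
    by transfer (auto simp: L2_rel_def mult.assoc)
  have sq: "(\<integral>x. f x * cnj (f x) \<partial>lborel) = complex_of_real (\<integral>x. (cmod (f x))\<^sup>2 \<partial>lborel)" for f
    by (simp only: complex_norm_square[symmetric] integral_complex_of_real)
  show "0 \<le> inner f f"
    unfolding inner_L2_def by transfer (simp add: sq)
  show "inner f f = 0 \<longleftrightarrow> f = 0"
    unfolding inner_L2_def
    by transfer (auto simp: sq L2_rel_def square_integrable_zero square_integrable_def
        integral_nonneg_eq_0_iff_AE)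
  show "norm f = sqrt (inner f f)" by (rule norm_L2_def)
qed

end

section \<open>Unbounded operators, represented by their graphs\<close>

definition linear_operator :: "(L2 \<times> L2) set \<Rightarrow> bool" where
  "linear_operator A \<longleftrightarrow> single_valued A \<and> 0 \<in> A \<and>
     (\<forall>(x, y) \<in> A. \<forall>(x', y') \<in> A. (x + x', y + y') \<in> A) \<and>
     (\<forall>c. \<forall>(x, y) \<in> A. (c *\<^sub>C x, c *\<^sub>C y) \<in> A)"

definition densely_defined :: "(L2 \<times> L2) set \<Rightarrow> bool" where
  "densely_defined A \<longleftrightarrow> closure (Domain A) = UNIV"

definition accretive :: "(L2 \<times> L2) set \<Rightarrow> bool" where
  "accretive A \<longleftrightarrow> linear_operator A \<and> (\<forall>(x, y) \<in> A. 0 \<le> Re (cinner y x))"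

text \<open>
  \<open>\<lambda>\<close> is in the resolvent set if \<open>A - \<lambda>\<close> maps the domain of \<open>A\<close> bijectively onto the whole space
  and has a bounded inverse.
\<close>

definition resolvent_set :: "(L2 \<times> L2) set \<Rightarrow> complex set" where
  "resolvent_set A = {l.
     (\<forall>z. \<exists>!x. \<exists>y. (x, y) \<in> A \<and> y - l *\<^sub>C x = z) \<and>
     (\<exists>C. \<forall>(x, y) \<in> A. norm x \<le> C * norm (y - l *\<^sub>C x))}"

definition m_accretive :: "(L2 \<times> L2) set \<Rightarrow> bool" where
  "m_accretive A \<longleftrightarrow> accretive A \<and> {l. Re l < 0} \<subseteq> resolvent_set A"

text \<open>The graph of the Hilbert space adjoint; it is single-valued iff \<open>A\<close> is densely defined.\<close>

definition adjoint_operator :: "(L2 \<times> L2) set \<Rightarrow> (L2 \<times> L2) set" where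
  "adjoint_operator A = {(g, h). \<forall>(x, y) \<in> A. cinner y g = cinner x h}"

section \<open>The differential operator\<close>

definition vderiv :: "(real \<Rightarrow> 'a::real_normed_vector) \<Rightarrow> real \<Rightarrow> 'a" where
  "vderiv f x = vector_derivative f (at x)"

definition smooth :: "(real \<Rightarrow> 'a::real_normed_vector) \<Rightarrow> bool" where
  "smooth f \<longleftrightarrow> (\<forall>n x. (vderiv ^^ n) f differentiable (at x))"

definition C_inf_comp :: "(real \<Rightarrow> complex) set" where
  "C_inf_comp = {u. smooth u \<and> compact (closure {x. u x \<noteq> 0})}"

definition diff_op :: "(real \<Rightarrow> real) \<Rightarrow> (real \<Rightarrow> real) \<Rightarrow> (real \<Rightarrow> complex) \<Rightarrow> real \<Rightarrow> complex" where
  "diff_op a b u x =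
     - vderiv (vderiv u) x + complex_of_real (a x) * vderiv u x + complex_of_real (b x) * u x"

definition L00 :: "(real \<Rightarrow> real) \<Rightarrow> (real \<Rightarrow> real) \<Rightarrow> (L2 \<times> L2) set" where
  "L00 a b = {(to_L2 u, to_L2 (diff_op a b u)) | u. u \<in> C_inf_comp}"

text \<open>
  The closure of an operator is taken in the graph topology. It is again the graph of an operator
  only if the operator is closable, which \<open>linear_operator (L0 a b)\<close>, a conjunct of
  \<open>accretive (L0 a b)\<close>, asserts.
\<close>

definition L0 :: "(real \<Rightarrow> real) \<Rightarrow> (real \<Rightarrow> real) \<Rightarrow> (L2 \<times> L2) set" where
  "L0 a b = closure (L00 a b)"

end

theory Submission
  imports Defs "HOL-Computational_Algebra.Polynomial"
begin

text \<open>
  Integration by parts on test functions \<open>u\<close> gives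
  \<open>Re (Lu, u) = \<integral> \<bar>u'\<bar>\<^sup>2 + \<integral> (b - a'/2) \<bar>u\<bar>\<^sup>2\<close>, and the formal adjoint is
  \<open>L\<^sup>+ g = - g'' - (a g)' + b g\<close>. The choice \<open>b = a'/2\<close> therefore makes the operator accretive
  whatever \<open>a\<close> is, and leaves \<open>a\<close> free to solve \<open>L\<^sup>+ v = - v\<close>. Multiplied by \<open>2v\<close>, that equation
  reads \<open>(a v\<^sup>2)' = 2 (v\<^sup>2 - v v'')\<close>, so \<open>a = 2 G / v\<^sup>2\<close> with any antiderivative \<open>G\<close> of
  \<open>v\<^sup>2 - v v''\<close> will do; this is smooth because \<open>v\<close> has no zeros. As \<open>v\<close> is square-integrable,
  the Lagrange identity (\<open>integral_Lagrange_identity\<close>) turns \<open>L\<^sup>+ v = - v\<close> into a statement about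
  the Hilbert space adjoint. Then \<open>v\<close> is a nonzero vector orthogonal to the range of \<open>L\<^sub>0 + 1\<close>, so
  \<open>-1\<close> lies in the spectrum (\<open>not_m_accretive_adjoint_eigenvector\<close>).

  That the closure is the graph of an operator at all follows from the same Lagrange identity:
  the adjoint is defined on every test function, and an operator whose adjoint has dense domain is
  closable (\<open>linear_operator_closure\<close>). Both this and the density of the domain rest on the density
  of the test functions in the Hilbert space (\<open>C_inf_comp_dense\<close>): their closure is a closed
  subspace containing the indicators of intervals, hence those of Borel sets by a Dynkin argument,
  hence everything.
\<close>

section \<open>Calculus of smooth functions\<close>

text \<open>
  Smoothness is proved throughout by exhibiting a class of differentiable functions that contains
  the given one and is closed under differentiation; no formula for higher derivatives is needed.
\<close>

lemma smooth_coinduct: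
  assumes "P f"
    and step: "\<And>g. P g \<Longrightarrow> \<exists>g'. P g' \<and> (\<forall>x. (g has_vector_derivative g' x) (at x))"
  shows "smooth f"
proof -
  have vd: "vderiv g = g'" if "\<forall>x. (g has_vector_derivative g' x) (at x)" for g g'
    using that by (auto simp: vderiv_def vector_derivative_at)
  have "P ((vderiv ^^ n) f)" for n
  proof (induction n)
    case (Suc n)
    obtain g' where "P g'" "\<forall>x. ((vderiv ^^ n) f has_vector_derivative g' x) (at x)"
      using step[OF Suc] by blast
    then show ?case
      by (metis vd funpow.simps(2) comp_apply)
  qed (simp add: assms)
  then show ?thesis
    unfolding smooth_def using step differentiableI_vector by blast
qed

lemma smooth_vderiv: "smooth f \<Longrightarrow> smooth (vderiv f)"
  unfolding smooth_def by (metis funpow_Suc_right comp_apply)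

lemma smooth_has_vderiv:
  assumes "smooth f"
  shows "(f has_vector_derivative vderiv f x) (at x)"
proof -
  have "(vderiv ^^ 0) f differentiable (at x)"
    using assms unfolding smooth_def by blast
  then show ?thesis
    by (simp add: vderiv_def vector_derivative_works)
qed

lemma vderiv_eqI: "(f has_vector_derivative d) (at x) \<Longrightarrow> vderiv f x = d"
  by (simp add: vderiv_def vector_derivative_at)

lemma smooth_continuous: "smooth f \<Longrightarrow> continuous_on A f"
  using smooth_has_vderiv has_vector_derivative_continuous
  by (metis continuous_at_imp_continuous_on)

lemma smooth_antiderivative:
  assumes "\<And>x. (F has_vector_derivative f x) (at x)" "smooth f"
  shows "smooth F"
  by (rule smooth_coinduct[where P = "\<lambda>g. g = F \<or> smooth g"])
    (use assms smooth_has_vderiv smooth_vderiv in blast)+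

lemma smooth_const: "smooth (\<lambda>x. c)"
  by (rule smooth_coinduct[where P = "\<lambda>g. \<exists>c. g = (\<lambda>x. c)"])
    (auto intro!: exI[of _ "\<lambda>x. 0"])

lemma smooth_bounded_linear:
  assumes "bounded_linear T" "smooth f"
  shows "smooth (\<lambda>x. T (f x))"
proof (rule smooth_coinduct[where P = "\<lambda>g. \<exists>f. smooth f \<and> g = (\<lambda>x. T (f x))"])
  fix g assume "\<exists>f. smooth f \<and> g = (\<lambda>x. T (f x))"
  then show "\<exists>g'. (\<exists>f. smooth f \<and> g' = (\<lambda>x. T (f x))) \<and> (\<forall>x. (g has_vector_derivative g' x) (at x))"
    using bounded_linear.has_vector_derivative[OF assms(1) smooth_has_vderiv] smooth_vderiv
    by blast
qed (use assms in blast)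

lemma smooth_add:
  assumes "smooth f" "smooth g"
  shows "smooth (\<lambda>x. f x + g x)"
proof (rule smooth_coinduct[where P = "\<lambda>h. \<exists>f g. smooth f \<and> smooth g \<and> h = (\<lambda>x. f x + g x)"])
  fix h :: "real \<Rightarrow> 'a" assume "\<exists>f g. smooth f \<and> smooth g \<and> h = (\<lambda>x. f x + g x)"
  then obtain f g where fg: "smooth f" "smooth g" "h = (\<lambda>x. f x + g x)"
    by blast
  then have "(h has_vector_derivative vderiv f x + vderiv g x) (at x)" for x
    by (auto intro!: has_vector_derivative_add smooth_has_vderiv)
  then show "\<exists>h'. (\<exists>f g. smooth f \<and> smooth g \<and> h' = (\<lambda>x. f x + g x)) \<and>
      (\<forall>x. (h has_vector_derivative h' x) (at x))"
    using fg smooth_vderiv by (intro exI[of _ "\<lambda>x. vderiv f x + vderiv g x"]) blast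
qed (use assms in blast)

lemma smooth_uminus: "smooth f \<Longrightarrow> smooth (\<lambda>x. - f x)"
  using smooth_bounded_linear[OF bounded_linear_minus[OF bounded_linear_ident]] .

lemma smooth_diff: "smooth f \<Longrightarrow> smooth g \<Longrightarrow> smooth (\<lambda>x. f x - g x)"
  using smooth_add[OF _ smooth_uminus] by force

text \<open>
  The products of two smooth functions are not closed under differentiation, but by the Leibniz rule
  their finite sums are.
\<close>

inductive sum_of_products :: "(real \<Rightarrow> 'a::real_normed_algebra) \<Rightarrow> bool" where
  product: "smooth f \<Longrightarrow> smooth g \<Longrightarrow> sum_of_products (\<lambda>x. f x * g x)"
| sum: "sum_of_products f \<Longrightarrow> sum_of_products g \<Longrightarrow> sum_of_products (\<lambda>x. f x + g x)"

lemma smooth_mult: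
  fixes f g :: "real \<Rightarrow> 'a::real_normed_algebra"
  assumes "smooth f" "smooth g"
  shows "smooth (\<lambda>x. f x * g x)"
proof (rule smooth_coinduct[where P = sum_of_products])
  fix h :: "real \<Rightarrow> 'a" assume "sum_of_products h"
  then show "\<exists>h'. sum_of_products h' \<and> (\<forall>x. (h has_vector_derivative h' x) (at x))"
  proof induction
    case (product f g)
    have "((\<lambda>x. f x * g x) has_vector_derivative f x * vderiv g x + vderiv f x * g x) (at x)" for x
      by (intro has_vector_derivative_mult smooth_has_vderiv product)
    moreover have "sum_of_products (\<lambda>x. f x * vderiv g x + vderiv f x * g x)"
      by (intro sum_of_products.intros product smooth_vderiv)
    ultimately show ?case by blast
  next
    case (sum f g)
    then obtain f' g' where "sum_of_products f'" "\<forall>x. (f has_vector_derivative f' x) (at x)"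
      "sum_of_products g'" "\<forall>x. (g has_vector_derivative g' x) (at x)" by blast
    then show ?case
      by (intro exI[of _ "\<lambda>x. f' x + g' x"])
        (auto intro!: sum_of_products.sum has_vector_derivative_add)
  qed
qed (use assms in \<open>rule sum_of_products.product\<close>)

text \<open>
  The power of the denominator must be arbitrary, because each differentiation raises it by one.
\<close>

lemma smooth_divide_power:
  fixes h v :: "real \<Rightarrow> real"
  assumes v: "smooth v" "\<And>x. v x \<noteq> 0" and "smooth h"
  shows "smooth (\<lambda>x. h x / v x ^ n)"
proof (rule smooth_coinduct[where P = "\<lambda>g. \<exists>h n. smooth h \<and> g = (\<lambda>x. h x / v x ^ n)"])
  fix g assume "\<exists>h n. smooth h \<and> g = (\<lambda>x. h x / v x ^ n)"
  then obtain h n where h: "smooth h" and g: "g = (\<lambda>x. h x / v x ^ n)" by blast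
  define k where "k = (\<lambda>x. vderiv h x * v x - (real n * h x) * vderiv v x)"
  have "smooth k"
    unfolding k_def by (intro smooth_diff smooth_mult smooth_const smooth_vderiv h v)
  moreover have "(g has_vector_derivative k x / v x ^ Suc n) (at x)" for x
  proof -
    have d: "(h has_real_derivative vderiv h x) (at x)" "(v has_real_derivative vderiv v x) (at x)"
      using smooth_has_vderiv[OF h] smooth_has_vderiv[OF v(1)]
      by (auto simp: has_real_derivative_iff_has_vector_derivative)
    show ?thesis
      unfolding has_real_derivative_iff_has_vector_derivative[symmetric] g k_def
    proof (cases n)
      case (Suc m)
      show "((\<lambda>x. h x / v x ^ n) has_real_derivative
          (vderiv h x * v x - real n * h x * vderiv v x) / v x ^ Suc n) (at x)"
        unfolding Suc by (rule DERIV_cong[OF DERIV_divide[OF d(1) DERIV_power_Suc[OF d(2)]]])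
          (use v(2)[of x] in \<open>simp_all add: field_simps\<close>)
    qed (use v(2)[of x] in \<open>auto intro!: derivative_eq_intros d simp: field_simps\<close>)
  qed
  ultimately show "\<exists>g'. (\<exists>h n. smooth h \<and> g' = (\<lambda>x. h x / v x ^ n)) \<and>
      (\<forall>x. (g has_vector_derivative g' x) (at x))"
    by blast
qed (use assms in blast)

text \<open>
  The chain rule produces a factor \<open>m\<close> at each differentiation, so the class carries an arbitrary
  scalar.
\<close>

lemma smooth_affine:
  fixes f :: "real \<Rightarrow> 'a::real_normed_vector"
  assumes "smooth f"
  shows "smooth (\<lambda>x. f (m * x + d))"
proof (rule smooth_coinduct[where P = "\<lambda>g. \<exists>c h. smooth h \<and> g = (\<lambda>x. c *\<^sub>R h (m * x + d))"])
  show "\<exists>c h. smooth h \<and> (\<lambda>x. f (m * x + d)) = (\<lambda>x. c *\<^sub>R h (m * x + d))"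
    using assms by (intro exI[of _ 1] exI[of _ f]) simp
next
  fix g :: "real \<Rightarrow> 'a" assume "\<exists>c h. smooth h \<and> g = (\<lambda>x. c *\<^sub>R h (m * x + d))"
  then obtain c h where h: "smooth h" and g: "g = (\<lambda>x. c *\<^sub>R h (m * x + d))" by blast
  have "((\<lambda>x. m * x + d) has_vector_derivative m) (at x)" for x
    unfolding has_real_derivative_iff_has_vector_derivative[symmetric]
    by (auto intro!: derivative_eq_intros)
  from vector_diff_chain_at[OF this smooth_has_vderiv[OF h]]
  have "(g has_vector_derivative (c * m) *\<^sub>R vderiv h (m * x + d)) (at x)" for x
    unfolding g using bounded_linear.has_vector_derivative[OF bounded_linear_scaleR_right]
    by (fastforce simp: o_def)
  then show "\<exists>g'. (\<exists>c h. smooth h \<and> g' = (\<lambda>x. c *\<^sub>R h (m * x + d))) \<and>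
      (\<forall>x. (g has_vector_derivative g' x) (at x))"
    using smooth_vderiv[OF h] by blast
qed

section \<open>Smooth bump functions\<close>

text \<open>
  The classical flat function \<open>exp (- c / x)\<close>, extended by \<open>0\<close> to \<open>x \<le> 0\<close>. The polynomial factor
  in \<open>1 / x\<close> makes the family closed under differentiation.
\<close>

definition flat_exp :: "real \<Rightarrow> real poly \<Rightarrow> real \<Rightarrow> real" where
  "flat_exp c p x = (if x > 0 then poly p (inverse x) * exp (- (c * inverse x)) else 0)"

lemma poly_times_exp_tendsto_0:
  fixes c :: real
  assumes "c > 0"
  shows "((\<lambda>y. poly p y * exp (- (c * y))) \<longlongrightarrow> 0) at_top"
proof -
  have "((\<lambda>y. coeff p i * y ^ i * exp (- (c * y))) \<longlongrightarrow> 0) at_top" for i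
  proof -
    have "filterlim (\<lambda>y. c * y) at_top at_top"
      using assms by (intro filterlim_tendsto_pos_mult_at_top[OF tendsto_const] filterlim_ident)
    from filterlim_compose[OF tendsto_power_div_exp_0[of i] this]
    have "((\<lambda>y. coeff p i / c ^ i * ((c * y) ^ i / exp (c * y))) \<longlongrightarrow> coeff p i / c ^ i * 0) at_top"
      by (rule tendsto_mult_left)
    moreover have "coeff p i / c ^ i * ((c * y) ^ i / exp (c * y)) = coeff p i * y ^ i * exp (- (c * y))"
      for y using assms by (simp add: power_mult_distrib exp_minus field_simps)
    ultimately show ?thesis by simp
  qed
  then have "((\<lambda>y. \<Sum>i\<le>degree p. coeff p i * y ^ i * exp (- (c * y))) \<longlongrightarrow> 0) at_top"
    by (intro tendsto_null_sum)
  then show ?thesis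
    by (simp add: poly_altdef sum_distrib_right)
qed

text \<open>
  In the variable \<open>y = 1 / x\<close>, for which \<open>dy/dx = - y\<^sup>2\<close>, the derivative of \<open>p(y) exp (- c y)\<close>
  is \<open>y\<^sup>2 (c p(y) - p'(y)) exp (- c y)\<close>. At the origin the difference quotient has the same form
  and tends to \<open>0\<close>.
\<close>

lemma flat_exp_deriv:
  assumes "c > 0"
  shows "(flat_exp c p has_real_derivative flat_exp c ([:0, 0, 1:] * (smult c p - pderiv p)) x) (at x)"
proof -
  let ?q = "[:0, 0, 1:] * (smult c p - pderiv p)"
  consider "x > 0" | "x < 0" | "x = 0" by linarith
  then show ?thesis
  proof cases
    case 1
    have "((\<lambda>x. poly p (inverse x) * exp (- (c * inverse x))) has_real_derivative
        flat_exp c ?q x) (at x)"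
      using 1 by (auto intro!: derivative_eq_intros simp: flat_exp_def algebra_simps power2_eq_square)
    then show ?thesis
      by (rule has_field_derivative_transform_within_open[of _ _ _ "{0<..}"])
        (use 1 in \<open>auto simp: flat_exp_def\<close>)
  next
    case 2
    have "((\<lambda>x. 0) has_real_derivative flat_exp c ?q x) (at x)"
      using 2 by (simp add: flat_exp_def)
    then show ?thesis
      by (rule has_field_derivative_transform_within_open[of _ _ _ "{..<0}"])
        (use 2 in \<open>auto simp: flat_exp_def\<close>)
  next
    case 3
    have "((\<lambda>y. flat_exp c p y / y) \<longlongrightarrow> 0) (at_right 0)"
    proof (rule Lim_transform_eventually)
      show "((\<lambda>y. poly (pCons 0 p) (inverse y) * exp (- (c * inverse y))) \<longlongrightarrow> 0) (at_right 0)"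
        by (rule filterlim_compose[OF poly_times_exp_tendsto_0[OF assms] filterlim_inverse_at_top_right])
      show "\<forall>\<^sub>F y in at_right 0. poly (pCons 0 p) (inverse y) * exp (- (c * inverse y)) = flat_exp c p y / y"
        using eventually_at_right_less[of "0::real"]
        by eventually_elim (simp add: flat_exp_def divide_inverse)
    qed
    moreover have "((\<lambda>y. flat_exp c p y / y) \<longlongrightarrow> 0) (at_left 0)"
      by (rule tendsto_eventually) (auto simp: eventually_at_filter flat_exp_def)
    ultimately have "((\<lambda>y. flat_exp c p y / y) \<longlongrightarrow> 0) (at 0)"
      by (simp add: filterlim_at_split)
    then show ?thesis
      using 3 by (simp add: has_field_derivative_iff flat_exp_def)
  qed
qed

lemma smooth_flat_exp:
  assumes "c > 0"
  shows "smooth (flat_exp c p)"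
proof (rule smooth_coinduct[where P = "\<lambda>g. \<exists>p. g = flat_exp c p"])
  fix g assume "\<exists>p. g = flat_exp c p"
  then show "\<exists>g'. (\<exists>p. g' = flat_exp c p) \<and> (\<forall>x. (g has_vector_derivative g' x) (at x))"
    using flat_exp_deriv[OF assms] by (auto simp: has_real_derivative_iff_has_vector_derivative)
qed blast

lemma flat_exp_1: "flat_exp c 1 x = (if x > 0 then exp (- (c / x)) else 0)"
  by (simp add: flat_exp_def divide_inverse)

lemma flat_exp_1_bounds: "c > 0 \<Longrightarrow> 0 \<le> flat_exp c 1 x \<and> flat_exp c 1 x \<le> 1"
  by (simp add: flat_exp_1)

lemma flat_exp_1_tendsto: "(\<lambda>k. flat_exp (1 / real (Suc k)) 1 x) \<longlonglongrightarrow> indicator {0<..} x"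
proof -
  have "(\<lambda>k. 1 / real (Suc k) / x) \<longlonglongrightarrow> 0"
    using tendsto_divide_zero[OF LIMSEQ_inverse_real_of_nat] by (simp only: inverse_eq_divide)
  from tendsto_exp[OF tendsto_minus[OF this]] show ?thesis
    by (simp add: flat_exp_1 indicator_def)
qed

text \<open>
  As \<open>c\<close> tends to \<open>0\<close>, the factor \<open>exp (- c / x)\<close> tends to \<open>1\<close> at every \<open>x > 0\<close>. This gives
  smooth functions, all supported in one interval and bounded by its indicator, that converge to
  that indicator at every point.
\<close>

definition bump :: "real \<Rightarrow> real \<Rightarrow> nat \<Rightarrow> real \<Rightarrow> real" where
  "bump l r k x = flat_exp (1 / real (Suc k)) 1 (x - l) * flat_exp (1 / real (Suc k)) 1 (r - x)"

lemma smooth_bump: "smooth (bump l r k)"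
  unfolding bump_def[abs_def]
  using smooth_affine[OF smooth_flat_exp, of "1 / real (Suc k)" 1 1 "- l"]
    smooth_affine[OF smooth_flat_exp, of "1 / real (Suc k)" 1 "- 1" r]
  by (intro smooth_mult) (simp_all add: add.commute)

lemma bump_eq_0: "x \<notin> {l<..<r} \<Longrightarrow> bump l r k x = 0"
  by (auto simp: bump_def flat_exp_1)

lemma bump_le_1: "\<bar>bump l r k x\<bar> \<le> 1"
proof -
  have "1 / real (Suc k) > 0" by simp
  from flat_exp_1_bounds[OF this] show ?thesis
    unfolding bump_def abs_mult by (intro mult_le_one) (auto simp del: of_nat_Suc)
qed

lemma bump_tendsto: "(\<lambda>k. bump l r k x) \<longlonglongrightarrow> indicator {l<..<r} x"
proof -
  have "indicator {l<..<r} x = (indicator {0<..} (x - l) * indicator {0<..} (r - x) :: real)"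
    by (auto simp: indicator_def)
  then show ?thesis
    unfolding bump_def using tendsto_mult[OF flat_exp_1_tendsto flat_exp_1_tendsto] by simp
qed

section \<open>Convergence in the space of square-integrable functions\<close>

lemma L2_rel_refl: "L2_rel f f \<longleftrightarrow> square_integrable f"
  by (simp add: L2_rel_def)

lemmas to_L2_simps = plus_L2.abs_eq[unfolded L2_rel_refl] minus_L2.abs_eq[unfolded L2_rel_refl]
  uminus_L2.abs_eq[unfolded L2_rel_refl] scaleC.abs_eq[unfolded L2_rel_refl]
  cinner.abs_eq[unfolded L2_rel_refl]

lemma to_L2_cases:
  obtains f where "square_integrable f" "z = to_L2 f"
  by (induction z rule: L2.abs_induct) (auto simp: L2_rel_refl)

lemma norm_to_L2:
  assumes "square_integrable f"
  shows "(norm (to_L2 f))\<^sup>2 = (\<integral>x. (cmod (f x))\<^sup>2 \<partial>lborel)"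
proof -
  have "cinner (to_L2 f) (to_L2 f) = complex_of_real (\<integral>x. (cmod (f x))\<^sup>2 \<partial>lborel)"
    using assms
    by (simp only: to_L2_simps complex_norm_square[symmetric] integral_complex_of_real)
  then show ?thesis
    by (simp add: power2_norm_eq_inner inner_L2_def)
qed

lemma square_integrable_bounded:
  assumes "f \<in> borel_measurable borel" "square_integrable g" "\<And>x. cmod (f x) \<le> cmod (g x)"
  shows "square_integrable f"
  unfolding square_integrable_def
proof
  show "integrable lborel (\<lambda>x. (cmod (f x))\<^sup>2)"
    by (rule Bochner_Integration.integrable_bound[of _ "\<lambda>x. (cmod (g x))\<^sup>2"])
      (use assms in \<open>auto simp: square_integrable_def intro!: power_mono\<close>)
qed (use assms in simp)

lemma square_integrable_indicator:
  assumes "A \<in> sets borel" "emeasure lborel A < \<infinity>"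
  shows "square_integrable (indicator A)"
proof -
  have "(\<lambda>x. (cmod (indicator A x))\<^sup>2) = (indicator A :: real \<Rightarrow> real)"
    by (auto simp: indicator_def)
  then show ?thesis
    using assms unfolding square_integrable_def by (auto simp: integrable_indicator_iff)
qed

lemma L2_dominated_convergence:
  assumes meas: "\<And>k. F k \<in> borel_measurable borel"
    and g: "square_integrable g" and bd: "\<And>k x. cmod (F k x) \<le> cmod (g x)"
    and lim: "\<And>x. (\<lambda>k. F k x) \<longlonglongrightarrow> f x"
  shows "(\<lambda>k. to_L2 (F k)) \<longlonglongrightarrow> to_L2 f"
proof -
  have fm: "f \<in> borel_measurable borel"
    by (rule borel_measurable_LIMSEQ_metric[OF meas lim])
  have fb: "cmod (f x) \<le> cmod (g x)" for x
    by (rule LIMSEQ_le_const2[OF tendsto_norm[OF lim]]) (use bd in auto)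
  have sq: "square_integrable f" "\<And>k. square_integrable (F k)"
    by (auto intro: square_integrable_bounded[OF _ g] fm meas fb bd)
  have "(\<lambda>k. \<integral>x. (cmod (F k x - f x))\<^sup>2 \<partial>lborel) \<longlonglongrightarrow> (\<integral>x. 0 \<partial>(lborel :: real measure))"
  proof (rule integral_dominated_convergence[where w = "\<lambda>x. 4 * (cmod (g x))\<^sup>2"])
    show "integrable lborel (\<lambda>x. 4 * (cmod (g x))\<^sup>2)"
      using g by (simp add: square_integrable_def)
    show "AE x in lborel. (\<lambda>k. (cmod (F k x - f x))\<^sup>2) \<longlonglongrightarrow> 0"
    proof (rule AE_I2)
      fix x
      have "(\<lambda>k. (cmod (F k x - f x))\<^sup>2) \<longlonglongrightarrow> (cmod (f x - f x))\<^sup>2"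
        by (intro tendsto_intros lim)
      then show "(\<lambda>k. (cmod (F k x - f x))\<^sup>2) \<longlonglongrightarrow> 0" by simp
    qed
    show "AE x in lborel. norm ((cmod (F k x - f x))\<^sup>2) \<le> 4 * (cmod (g x))\<^sup>2" for k
    proof (rule AE_I2)
      fix x
      have "cmod (F k x - f x) \<le> 2 * cmod (g x)"
        using norm_triangle_ineq4[of "F k x" "f x"] bd[of k x] fb[of x] by linarith
      from power_mono[OF this, of 2] show "norm ((cmod (F k x - f x))\<^sup>2) \<le> 4 * (cmod (g x))\<^sup>2"
        by (simp add: power_mult_distrib)
    qed
  qed (use fm meas in simp_all)
  then have "(\<lambda>k. (norm (to_L2 (F k) - to_L2 f))\<^sup>2) \<longlonglongrightarrow> 0"
    using sq by (simp add: to_L2_simps norm_to_L2 square_integrable_diff)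
  from tendsto_real_sqrt[OF this] have "(\<lambda>k. norm (to_L2 (F k) - to_L2 f)) \<longlonglongrightarrow> 0"
    by simp
  then show ?thesis
    by (simp add: LIM_zero_iff tendsto_norm_zero_iff)
qed


section \<open>Closed subspaces containing the indicators of intervals\<close>

lemma closure_add_mem:
  fixes S :: "'a::real_normed_vector set"
  assumes "\<And>x y. x \<in> S \<Longrightarrow> y \<in> S \<Longrightarrow> x + y \<in> S" "x \<in> closure S" "y \<in> closure S"
  shows "x + y \<in> closure S"
proof -
  have "(\<lambda>p. fst p + snd p) ` closure (S \<times> S) \<subseteq> closure S"
    by (rule image_closure_subset)
      (use assms(1) closure_subset[of S] in \<open>auto intro!: continuous_intros\<close>)
  then show ?thesis
    using assms by (force simp: closure_Times)
qed

lemma norm_scaleC: "norm (c *\<^sub>C z) = cmod c * norm z"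
proof (rule to_L2_cases[of z])
  fix f assume f: "square_integrable f" "z = to_L2 f"
  then have "(norm (c *\<^sub>C z))\<^sup>2 = (cmod c * norm z)\<^sup>2"
    by (simp add: to_L2_simps norm_to_L2 square_integrable_mult norm_mult power_mult_distrib)
  then show ?thesis
    by (simp add: power2_eq_iff_nonneg)
qed

lemma bounded_linear_scaleC: "bounded_linear (\<lambda>z. c *\<^sub>C z)"
proof (rule bounded_linear_intro[where K = "cmod c"])
  fix z w :: L2 and r
  show "c *\<^sub>C (z + w) = c *\<^sub>C z + c *\<^sub>C w"
    by (rule to_L2_cases[of z], rule to_L2_cases[of w])
      (simp add: to_L2_simps square_integrable_add square_integrable_mult distrib_left)
  show "c *\<^sub>C (r *\<^sub>R z) = r *\<^sub>R (c *\<^sub>C z)"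
    by (rule to_L2_cases[of z])
      (simp add: scaleR_L2_def to_L2_simps square_integrable_mult mult.left_commute)
qed (simp add: norm_scaleC mult.commute)

lemmas continuous_on_scaleC = bounded_linear.continuous_on[OF bounded_linear_scaleC]

text \<open>
  The half-lines \<open>{..<a}\<close> generate the Borel sets and are closed under intersection, and the sets \<open>A\<close>
  with the stated property form a Dynkin system. Cutting \<open>A\<close> down to a bounded interval keeps the
  indicators square-integrable, also for complements.
\<close>

lemma closed_subspace_contains_sets:
  assumes "closed D"
    and add: "\<And>x y. x \<in> D \<Longrightarrow> y \<in> D \<Longrightarrow> x + y \<in> D"
    and scale: "\<And>c x. x \<in> D \<Longrightarrow> c *\<^sub>C x \<in> D"
    and ivl: "\<And>l r. to_L2 (indicator {l<..<r}) \<in> D"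
    and A: "A \<in> sets borel"
  shows "to_L2 (indicator (A \<inter> {l<..<r})) \<in> D"
proof -
  let ?I = "{l<..<r}"
  have bdd: "square_integrable (indicator (B \<inter> ?I))" if "B \<in> sets borel" for B
    using that by (intro square_integrable_indicator emeasure_bounded_finite)
      (auto intro: bounded_subset[of ?I])
  have "indicator {0<..<0} = (\<lambda>x :: real. 0 :: complex)"
    by auto
  then have zero: "to_L2 (\<lambda>x. 0) \<in> D"
    using ivl[of 0 0] by simp
  have gen: "sets borel = sigma_sets UNIV (range (lessThan :: real \<Rightarrow> _))"
    by (simp add: borel_Iio sets_measure_of)
  have "{..<a} \<inter> {..<b} = {..<min a b}" for a b :: real
    by auto
  then have "Int_stable (range (lessThan :: real \<Rightarrow> _))"
    by (auto simp: Int_stable_def)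
  moreover have "range (lessThan :: real \<Rightarrow> _) \<subseteq> Pow UNIV"
    by simp
  moreover have "A \<in> sigma_sets UNIV (range lessThan)"
    using A by (simp only: gen)
  ultimately show ?thesis
  proof (induction rule: sigma_sets_induct_disjoint)
    case (basic A)
    then obtain a where "A = {..<a}" by auto
    then have "A \<inter> ?I = {l<..<min a r}" by auto
    then show ?case using ivl by metis
  next
    case empty
    then show ?case using zero by simp
  next
    case (compl A)
    then have "A \<in> sets borel" by (simp add: gen)
    then have sq: "square_integrable (indicator (A \<inter> ?I))" "square_integrable (indicator ?I)"
      using bdd[of UNIV] by (auto intro: bdd)
    have "indicator ((UNIV - A) \<inter> ?I) = (\<lambda>x. indicator ?I x + - 1 * indicator (A \<inter> ?I) x :: complex)"
      by (auto simp: indicator_def)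
    then have "to_L2 (indicator ((UNIV - A) \<inter> ?I)) =
        to_L2 (indicator ?I) + (- 1) *\<^sub>C to_L2 (indicator (A \<inter> ?I))"
      using sq by (simp add: to_L2_simps square_integrable_uminus)
    then show ?case
      using add[OF ivl scale[OF compl(2)]] by simp
  next
    case (union A)
    have Ab: "A i \<in> sets borel" for i
      using union(2) by (auto simp: gen)
    define B where "B k = (\<Union>i<k. A i)" for k :: nat
    have Bb: "B k \<in> sets borel" for k
      unfolding B_def using Ab by auto
    have BD: "to_L2 (indicator (B k \<inter> ?I)) \<in> D" for k
    proof (induction k)
      case 0
      then show ?case using zero by (simp add: B_def)
    next
      case (Suc k)
      have "x \<notin> A k" if "x \<in> B k" for x
      proof -
        from that obtain i where "i < k" "x \<in> A i" by (auto simp: B_def)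
        then show ?thesis
          using disjoint_family_onD[OF union(1), of i k] by auto
      qed
      then have "indicator (B (Suc k) \<inter> ?I) =
          (\<lambda>x. indicator (B k \<inter> ?I) x + indicator (A k \<inter> ?I) x :: complex)"
        by (intro ext) (auto simp: B_def indicator_def lessThan_Suc)
      then have "to_L2 (indicator (B (Suc k) \<inter> ?I)) =
          to_L2 (indicator (B k \<inter> ?I)) + to_L2 (indicator (A k \<inter> ?I))"
        using bdd[OF Bb] bdd[OF Ab] by (simp add: to_L2_simps)
      then show ?case using add[OF Suc union(3)] by simp
    qed
    have "(\<lambda>k. to_L2 (indicator (B k \<inter> ?I))) \<longlonglongrightarrow> to_L2 (indicator ((\<Union>i. A i) \<inter> ?I))"
    proof (rule L2_dominated_convergence)
      show "square_integrable (indicator ?I)"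
        using bdd[of UNIV] by simp
      show "(\<lambda>k. indicator (B k \<inter> ?I) x :: complex) \<longlonglongrightarrow> indicator ((\<Union>i. A i) \<inter> ?I) x" for x
        unfolding B_def indicator_inter_arith
        by (intro tendsto_mult LIMSEQ_indicator_UN tendsto_const)
    qed (use Bb in \<open>auto simp: indicator_def\<close>)
    then show ?case
      by (rule closed_sequentially[OF \<open>closed D\<close> BD])
  qed
qed

text \<open>
  Nonnegative functions are increasing limits of simple ones, and every function is a combination of
  the positive and negative parts of its real and imaginary parts. All approximants are dominated by
  the function to be reached, so pointwise convergence is convergence in norm.
\<close>

lemma closed_subspace_eq_UNIV:
  assumes "closed D"
    and add: "\<And>x y. x \<in> D \<Longrightarrow> y \<in> D \<Longrightarrow> x + y \<in> D"
    and scale: "\<And>c x. x \<in> D \<Longrightarrow> c *\<^sub>C x \<in> D"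
    and ivl: "\<And>l r. to_L2 (indicator {l<..<r}) \<in> D"
  shows "D = UNIV"
proof -
  have "indicator {0<..<0} = (\<lambda>x :: real. 0 :: complex)"
    by auto
  then have zero: "to_L2 (\<lambda>x. 0) \<in> D"
    using ivl[of 0 0] by simp
  have nonneg: "square_integrable (\<lambda>x. complex_of_real (u x)) \<longrightarrow> to_L2 (\<lambda>x. complex_of_real (u x)) \<in> D"
    if "u \<in> borel_measurable borel" "\<And>x. 0 \<le> u x" for u :: "real \<Rightarrow> real"
    using that
  proof (induction rule: borel_measurable_induct_real)
    case (set A)
    show ?case
    proof
      have ci: "(\<lambda>x. complex_of_real (indicator A x)) = indicator A"
        by (auto simp: indicator_def)
      assume "square_integrable (\<lambda>x. complex_of_real (indicator A x))"
      then have sq: "square_integrable (indicator A)" by (simp only: ci)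
      have "(\<lambda>k. to_L2 (indicator (A \<inter> {- real k<..<real k}))) \<longlonglongrightarrow> to_L2 (indicator A)"
      proof (rule L2_dominated_convergence[OF _ sq])
        fix x :: real
        obtain n where n: "\<bar>x\<bar> < real n" using reals_Archimedean2 by blast
        have "\<forall>\<^sub>F k in sequentially. indicator (A \<inter> {- real k<..<real k}) x = (indicator A x :: complex)"
          using eventually_ge_at_top[of n]
        proof eventually_elim
          case (elim k)
          then have "real n \<le> real k" by simp
          then show ?case using n by (auto simp: indicator_def)
        qed
        then show "(\<lambda>k. indicator (A \<inter> {- real k<..<real k}) x :: complex) \<longlonglongrightarrow> indicator A x"
          by (rule tendsto_eventually)
      qed (use set in \<open>auto simp: indicator_def\<close>)
      moreover have "to_L2 (indicator (A \<inter> {- real k<..<real k})) \<in> D" for k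
        by (rule closed_subspace_contains_sets[OF assms set])
      ultimately have "to_L2 (indicator A) \<in> D"
        by (rule closed_sequentially[OF \<open>closed D\<close>, rotated])
      then show "to_L2 (\<lambda>x. complex_of_real (indicator A x)) \<in> D" by (simp only: ci)
    qed
  next
    case (mult u c)
    show ?case
    proof
      assume a: "square_integrable (\<lambda>x. complex_of_real (c * u x))"
      show "to_L2 (\<lambda>x. complex_of_real (c * u x)) \<in> D"
      proof (cases "c = 0")
        case False
        then have "square_integrable (\<lambda>x. complex_of_real (u x))"
          using square_integrable_mult[OF a, of "inverse c"] by (simp add: field_simps)
        then show ?thesis
          using scale[of "to_L2 (\<lambda>x. complex_of_real (u x))" "complex_of_real c"] mult
          by (simp add: to_L2_simps)
      qed (simp add: zero)
    qed
  next
    case (add u v)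
    show ?case
    proof
      assume a: "square_integrable (\<lambda>x. complex_of_real (v x + u x))"
      have "square_integrable (\<lambda>x. complex_of_real (v x))" "square_integrable (\<lambda>x. complex_of_real (u x))"
        by (rule square_integrable_bounded[OF _ a]; use add in \<open>simp flip: of_real_add\<close>)+
      then show "to_L2 (\<lambda>x. complex_of_real (v x + u x)) \<in> D"
        using assms(2)[of "to_L2 (\<lambda>x. complex_of_real (v x))" "to_L2 (\<lambda>x. complex_of_real (u x))"] add
        by (simp add: to_L2_simps)
    qed
  next
    case (seq U)
    show ?case
    proof
      assume a: "square_integrable (\<lambda>x. complex_of_real (u x))"
      have le: "U i x \<le> u x" for i x
        by (rule incseq_le) (use seq in \<open>auto simp: incseq_def le_fun_def\<close>)
      have bd: "cmod (complex_of_real (U i x)) \<le> cmod (complex_of_real (u x))" for i x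
        using le[of i x] seq(2)[of i x] by simp
      have "(\<lambda>i. to_L2 (\<lambda>x. complex_of_real (U i x))) \<longlonglongrightarrow> to_L2 (\<lambda>x. complex_of_real (u x))"
        by (rule L2_dominated_convergence[OF _ a bd]) (use seq in \<open>auto intro!: tendsto_of_real\<close>)
      moreover have "square_integrable (\<lambda>x. complex_of_real (U i x))" for i
        by (rule square_integrable_bounded[OF _ a bd]) (use seq in simp)
      then have "to_L2 (\<lambda>x. complex_of_real (U i x)) \<in> D" for i
        using seq.IH by blast
      ultimately show "to_L2 (\<lambda>x. complex_of_real (u x)) \<in> D"
        by (rule closed_sequentially[OF \<open>closed D\<close>, rotated])
    qed
  qed
  have real: "to_L2 (\<lambda>x. complex_of_real (u x)) \<in> D"
    if sq: "square_integrable (\<lambda>x. complex_of_real (u x))" for u :: "real \<Rightarrow> real"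
  proof -
    have um: "u \<in> borel_measurable borel"
      using sq by (simp add: square_integrable_def borel_measurable_complex_iff)
    have pm: "square_integrable (\<lambda>x. complex_of_real (max 0 (u x)))"
      "square_integrable (\<lambda>x. complex_of_real (max 0 (- u x)))"
      by (rule square_integrable_bounded[OF _ sq]; use um in simp)+
    have "(\<lambda>x. complex_of_real (u x)) =
        (\<lambda>x. complex_of_real (max 0 (u x)) + - 1 * complex_of_real (max 0 (- u x)))"
      by (auto simp: max_def)
    then have "to_L2 (\<lambda>x. complex_of_real (u x)) =
        to_L2 (\<lambda>x. complex_of_real (max 0 (u x))) + (- 1) *\<^sub>C to_L2 (\<lambda>x. complex_of_real (max 0 (- u x)))"
      using pm by (simp add: to_L2_simps square_integrable_uminus)
    also have "\<dots> \<in> D"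
      using nonneg pm um by (intro add scale) auto
    finally show ?thesis .
  qed
  have "z \<in> D" for z
  proof (rule to_L2_cases[of z])
    fix f assume f: "square_integrable f" "z = to_L2 f"
    have m: "f \<in> borel_measurable borel"
      using f by (simp add: square_integrable_def)
    have ri: "square_integrable (\<lambda>x. complex_of_real (Re (f x)))"
      "square_integrable (\<lambda>x. complex_of_real (Im (f x)))"
      by (rule square_integrable_bounded[OF _ f(1)]; use m in \<open>simp add: abs_Re_le_cmod abs_Im_le_cmod\<close>)+
    have "z = to_L2 (\<lambda>x. complex_of_real (Re (f x)) + \<i> * complex_of_real (Im (f x)))"
      unfolding f(2) by (simp flip: complex_eq)
    also have "\<dots> = to_L2 (\<lambda>x. complex_of_real (Re (f x))) + \<i> *\<^sub>C to_L2 (\<lambda>x. complex_of_real (Im (f x)))"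
      using ri by (simp add: to_L2_simps square_integrable_mult)
    also have "\<dots> \<in> D"
      by (intro add scale real ri)
    finally show ?thesis .
  qed
  then show ?thesis by auto
qed

section \<open>Test functions\<close>

lemma C_inf_comp_vanish:
  assumes "u \<in> C_inf_comp"
  obtains R where "\<forall>x. R < \<bar>x\<bar> \<longrightarrow> u x = 0"
proof -
  have "bounded {x. u x \<noteq> 0}"
    using assms unfolding C_inf_comp_def
    by (auto intro: bounded_subset[OF compact_imp_bounded closure_subset])
  then obtain R where "R > 0" "\<forall>x\<in>{x. u x \<noteq> 0}. norm x \<le> R"
    by (auto simp: bounded_pos)
  then show ?thesis
    using that[of R] by force
qed

lemma C_inf_compI:
  assumes "smooth u" "\<And>x. R < \<bar>x\<bar> \<Longrightarrow> u x = 0"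
  shows "u \<in> C_inf_comp"
proof -
  have "bounded {x. u x \<noteq> 0}"
    unfolding bounded_iff using assms(2) by (metis (mono_tags) linorder_not_le mem_Collect_eq real_norm_def)
  then show ?thesis
    using assms(1) by (simp add: C_inf_comp_def)
qed

lemma continuous_compact_support_integrable:
  fixes f :: "real \<Rightarrow> 'a::{banach, second_countable_topology}"
  assumes "continuous_on UNIV f" "\<And>x. R < \<bar>x\<bar> \<Longrightarrow> f x = 0"
  shows "integrable lborel f"
proof -
  have "integrable lborel (\<lambda>x. indicator {- R..R} x *\<^sub>R f x)"
    by (rule borel_integrable_compact) (use continuous_on_subset[OF assms(1)] in auto)
  moreover have "(\<lambda>x. indicator {- R..R} x *\<^sub>R f x) = f"
    using assms(2) by (force simp: indicator_def)
  ultimately show ?thesis by simp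
qed

lemma continuous_compact_support_square_integrable:
  assumes "continuous_on UNIV f" "\<And>x. R < \<bar>x\<bar> \<Longrightarrow> f x = 0"
  shows "square_integrable f"
  unfolding square_integrable_def
proof
  show "f \<in> borel_measurable lborel"
    using borel_measurable_continuous_onI[OF assms(1)] by simp
  show "integrable lborel (\<lambda>x. (cmod (f x))\<^sup>2)"
    by (rule continuous_compact_support_integrable[of _ R])
      (use assms in \<open>auto intro!: continuous_intros\<close>)
qed

lemma C_inf_comp_smooth: "u \<in> C_inf_comp \<Longrightarrow> smooth u"
  by (simp add: C_inf_comp_def)

lemma C_inf_comp_square_integrable:
  assumes "u \<in> C_inf_comp"
  shows "square_integrable u"
  by (rule C_inf_comp_vanish[OF assms])
    (auto intro: continuous_compact_support_square_integrable smooth_continuous C_inf_comp_smooth assms)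

lemma C_inf_comp_add: "u \<in> C_inf_comp \<Longrightarrow> w \<in> C_inf_comp \<Longrightarrow> (\<lambda>x. u x + w x) \<in> C_inf_comp"
proof -
  assume a: "u \<in> C_inf_comp" "w \<in> C_inf_comp"
  obtain R where "\<forall>x. R < \<bar>x\<bar> \<longrightarrow> u x = 0"
    by (rule C_inf_comp_vanish[OF a(1)])
  moreover obtain S where "\<forall>x. S < \<bar>x\<bar> \<longrightarrow> w x = 0"
    by (rule C_inf_comp_vanish[OF a(2)])
  ultimately show ?thesis
    using a by (intro C_inf_compI[of _ "max R S"] smooth_add) (auto simp: C_inf_comp_def)
qed

lemma C_inf_comp_mult:
  assumes "u \<in> C_inf_comp"
  shows "(\<lambda>x. c * u x) \<in> C_inf_comp"
proof -
  obtain R where "\<forall>x. R < \<bar>x\<bar> \<longrightarrow> u x = 0"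
    by (rule C_inf_comp_vanish[OF assms])
  then show ?thesis
    by (intro C_inf_compI[of _ R, OF smooth_bounded_linear[OF bounded_linear_mult_right
        C_inf_comp_smooth[OF assms]]]) simp
qed

lemma C_inf_comp_dense: "closure (to_L2 ` C_inf_comp) = UNIV"
proof (rule closed_subspace_eq_UNIV)
  let ?T = "to_L2 ` C_inf_comp"
  show "x + y \<in> closure ?T" if "x \<in> closure ?T" "y \<in> closure ?T" for x y
    by (rule closure_add_mem[OF _ that])
      (auto simp: to_L2_simps C_inf_comp_square_integrable intro!: imageI C_inf_comp_add)
  show "c *\<^sub>C x \<in> closure ?T" if "x \<in> closure ?T" for c x
  proof -
    have "(\<lambda>z. c *\<^sub>C z) ` closure ?T \<subseteq> closure ?T"
    proof (rule image_closure_subset)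
      show "(\<lambda>z. c *\<^sub>C z) ` ?T \<subseteq> closure ?T"
        by (auto simp: to_L2_simps C_inf_comp_square_integrable
            intro!: subsetD[OF closure_subset] imageI C_inf_comp_mult)
    qed (auto intro!: continuous_on_scaleC continuous_intros)
    then show ?thesis using that by blast
  qed
  fix l r :: real
  have "(\<lambda>k. to_L2 (\<lambda>x. complex_of_real (bump l r k x))) \<longlonglongrightarrow> to_L2 (indicator {l<..<r})"
  proof (rule L2_dominated_convergence[where g = "indicator {l<..<r}"])
    show "square_integrable (indicator {l<..<r})"
      by (intro square_integrable_indicator emeasure_bounded_finite) auto
    show "(\<lambda>x. complex_of_real (bump l r k x)) \<in> borel_measurable borel" for k
      using borel_measurable_continuous_onI[OF smooth_continuous[OF smooth_bump]] by simp
    show "cmod (complex_of_real (bump l r k x)) \<le> cmod (indicator {l<..<r} x)" for k x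
      using bump_le_1[of l r k x] bump_eq_0[of x l r k] by (auto simp: indicator_def)
    have "complex_of_real (indicator {l<..<r} x) = indicator {l<..<r} x" for x
      by (simp add: indicator_def)
    then show "(\<lambda>k. complex_of_real (bump l r k x)) \<longlonglongrightarrow> indicator {l<..<r} x" for x
      using tendsto_of_real[OF bump_tendsto[of l r x], where 'a = complex] by simp
  qed
  moreover have "(\<lambda>x. complex_of_real (bump l r k x)) \<in> C_inf_comp" for k
    by (rule C_inf_compI[of _ "max \<bar>l\<bar> \<bar>r\<bar>"])
      (auto intro!: smooth_bounded_linear[OF bounded_linear_of_real] smooth_bump bump_eq_0)
  ultimately show "to_L2 (indicator {l<..<r}) \<in> closure ?T"
    unfolding closure_sequential
    by (intro exI[of _ "\<lambda>k. to_L2 (\<lambda>x. complex_of_real (bump l r k x))"]) auto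
qed simp


section \<open>Closures and adjoints of graphs\<close>

lemma inner_adjoint:
  assumes "cinner y g = cinner x h"
  shows "inner y g = inner x h"
  using assms by (simp add: inner_L2_def)

lemma cinner_scaleC_left: "cinner (c *\<^sub>C x) y = c * cinner x y"
  by (rule to_L2_cases[of x], rule to_L2_cases[of y])
    (simp add: to_L2_simps square_integrable_mult mult.assoc)

lemma cinner_eq_inner: "cinner x y = Complex (inner x y) (inner ((- \<i>) *\<^sub>C x) y)"
  by (simp add: complex_eq_iff inner_L2_def cinner_scaleC_left)

lemma continuous_on_cinner_left:
  assumes "continuous_on A f"
  shows "continuous_on A (\<lambda>x. cinner (f x) g)"
  unfolding cinner_eq_inner
  by (intro continuous_on_Complex continuous_on_inner continuous_on_scaleC continuous_on_const assms)

lemma adjoint_closure: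
  assumes "(g, h) \<in> adjoint_operator A"
  shows "(g, h) \<in> adjoint_operator (closure A)"
proof -
  have "closure A \<subseteq> {p. cinner (snd p) g = cinner (fst p) h}"
  proof (rule closure_minimal)
    show "A \<subseteq> {p. cinner (snd p) g = cinner (fst p) h}"
      using assms by (auto simp: adjoint_operator_def)
    show "closed {p. cinner (snd p) g = cinner (fst p) h}"
      by (intro closed_Collect_eq continuous_on_cinner_left continuous_intros)
  qed
  then show ?thesis
    by (auto simp: adjoint_operator_def)
qed

text \<open>
  If \<open>y\<close> and \<open>z\<close> are both values of \<open>A\<close> at \<open>x\<close>, then \<open>y - z\<close> is orthogonal to the domain of the
  adjoint.
\<close>

lemma single_valued_dense_adjoint:
  assumes "closure (Domain (adjoint_operator A)) = UNIV"
  shows "single_valued A"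
proof (rule single_valuedI)
  fix x y z assume "(x, y) \<in> A" "(x, z) \<in> A"
  then have "cinner y g = cinner x h" "cinner z g = cinner x h"
    if "(g, h) \<in> adjoint_operator A" for g h
    using that by (auto simp: adjoint_operator_def)
  then have "inner y g = inner z g" if "(g, h) \<in> adjoint_operator A" for g h
    using inner_adjoint that by metis
  then have "inner (y - z) g = 0" if "(g, h) \<in> adjoint_operator A" for g h
    using that by (simp add: inner_diff_left)
  then have "closure (Domain (adjoint_operator A)) \<subseteq> {g. inner (y - z) g = 0}"
    by (intro closure_minimal closed_Collect_eq continuous_intros) auto
  then have "inner (y - z) (y - z) = 0"
    using assms by blast
  then show "y = z" by simp
qed

text \<open>
  Von Neumann's criterion for closability: passing to the closure does not change the adjoint, so
  its dense domain makes the closure single-valued too.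
\<close>

lemma linear_operator_closure:
  assumes "linear_operator A" "closure (Domain (adjoint_operator A)) = UNIV"
  shows "linear_operator (closure A)"
  unfolding linear_operator_def
proof (intro conjI allI ballI, safe)
  have "closure (Domain (adjoint_operator A)) \<subseteq> closure (Domain (adjoint_operator (closure A)))"
    by (intro closure_mono) (auto intro: adjoint_closure)
  then show "single_valued (closure A)"
    using assms(2) by (intro single_valued_dense_adjoint) auto
  show "0 \<in> closure A"
    using assms(1) closure_subset unfolding linear_operator_def by blast
  show "(x + x', y + y') \<in> closure A" if "(x, y) \<in> closure A" "(x', y') \<in> closure A" for x y x' y'
    using closure_add_mem[OF _ that] assms(1) by (fastforce simp: linear_operator_def)
  fix c x y assume xy: "(x, y) \<in> closure A"
  have "(\<lambda>p. (c *\<^sub>C fst p, c *\<^sub>C snd p)) ` closure A \<subseteq> closure A"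
  proof (rule image_closure_subset)
    show "(\<lambda>p. (c *\<^sub>C fst p, c *\<^sub>C snd p)) ` A \<subseteq> closure A"
      using assms(1) closure_subset[of A] by (fastforce simp: linear_operator_def)
  qed (auto intro!: continuous_on_Pair continuous_on_scaleC continuous_intros)
  then show "(c *\<^sub>C x, c *\<^sub>C y) \<in> closure A"
    using xy by force
qed

lemma accretive_closure:
  assumes "accretive A" "closure (Domain (adjoint_operator A)) = UNIV"
  shows "accretive (closure A)"
proof -
  have "closure A \<subseteq> {p. 0 \<le> inner (snd p) (fst p)}"
    using assms(1)
    by (intro closure_minimal closed_Collect_le continuous_intros)
      (auto simp: accretive_def inner_L2_def)
  then show ?thesis
    using assms linear_operator_closure by (auto simp: accretive_def inner_L2_def)
qed

text \<open>
  The vector \<open>g\<close> is orthogonal to the range of \<open>A + 1\<close>, whereas \<open>-1\<close> in the resolvent set would put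
  \<open>g\<close> itself into that range.
\<close>

lemma not_m_accretive_adjoint_eigenvector:
  assumes "(g, - g) \<in> adjoint_operator A" "g \<noteq> 0"
  shows "\<not> m_accretive A"
proof
  assume "m_accretive A"
  then have "- 1 \<in> resolvent_set A"
    by (auto simp: m_accretive_def)
  then obtain x y where xy: "(x, y) \<in> A" "y - (- 1) *\<^sub>C x = g"
    unfolding resolvent_set_def by blast
  have "(- 1) *\<^sub>C x = - x"
    by (rule to_L2_cases[of x]) (simp add: to_L2_simps)
  then have g: "g = y + x" using xy(2) by simp
  have "inner y g = inner x (- g)"
    using assms(1) xy(1) by (intro inner_adjoint) (auto simp: adjoint_operator_def)
  then have "inner (y + x) g = 0"
    by (simp add: inner_add_left)
  then show False
    using g assms(2) by simp
qed

section \<open>The differential operator and its formal adjoint\<close>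

lemma vderiv_vanish:
  assumes "\<And>x. R < \<bar>x\<bar> \<Longrightarrow> f x = 0" "R < \<bar>x\<bar>"
  shows "vderiv f x = 0"
proof (rule vderiv_eqI)
  have "open {x. R < \<bar>x :: real\<bar>}"
    by (intro open_Collect_less continuous_intros)
  then show "(f has_vector_derivative 0) (at x)"
    using has_vector_derivative_transform_within_open[of "\<lambda>x. 0" 0 x "{x. R < \<bar>x\<bar>}" f] assms
    by simp
qed

lemma integral_deriv_compact_support:
  fixes F f :: "real \<Rightarrow> 'a::euclidean_space"
  assumes d: "\<And>x. (F has_vector_derivative f x) (at x)"
    and f: "continuous_on UNIV f" and van: "\<And>x. R < \<bar>x\<bar> \<Longrightarrow> F x = 0"
  shows "integrable lborel f" "(\<integral>x. f x \<partial>lborel) = 0"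
proof -
  have f0: "f x = 0" if "R < \<bar>x\<bar>" for x
    using vderiv_vanish[of R F, OF van that] vderiv_eqI[OF d[of x]] by simp
  then show "integrable lborel f"
    by (rule continuous_compact_support_integrable[OF f])
  define S where "S = \<bar>R\<bar> + 1"
  have "(\<integral>x. indicator {- S..S} x *\<^sub>R f x \<partial>lborel) = F S - F (- S)"
    by (rule integral_FTC_Icc)
      (use d continuous_on_subset[OF f] in \<open>auto simp: S_def intro: has_vector_derivative_at_within\<close>)
  moreover have "(\<lambda>x. indicator {- S..S} x *\<^sub>R f x) = f"
    using f0 by (force simp: indicator_def S_def)
  ultimately show "(\<integral>x. f x \<partial>lborel) = 0"
    using van[of S] van[of "- S"] by (simp add: S_def)
qed

text \<open>
  The formal adjoint \<open>- g'' - (a g)' + b g\<close>, with the product \<open>a g\<close> differentiated out.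
\<close>

definition formal_adjoint ::
    "(real \<Rightarrow> real) \<Rightarrow> (real \<Rightarrow> real) \<Rightarrow> (real \<Rightarrow> complex) \<Rightarrow> real \<Rightarrow> complex" where
  "formal_adjoint a b g x = - vderiv (vderiv g) x -
     (complex_of_real (a x) * vderiv g x + complex_of_real (vderiv a x) * g x) +
     complex_of_real (b x) * g x"

lemma has_vector_derivative_of_real_smooth:
  assumes "smooth a"
  shows "((\<lambda>x. complex_of_real (a x)) has_vector_derivative complex_of_real (vderiv a x)) (at x)"
  by (rule bounded_linear.has_vector_derivative[OF bounded_linear_of_real smooth_has_vderiv[OF assms]])

lemma vderiv_cnj: "smooth g \<Longrightarrow> vderiv (\<lambda>x. cnj (g x)) = (\<lambda>x. cnj (vderiv g x))"
  using bounded_linear.has_vector_derivative[OF bounded_linear_cnj smooth_has_vderiv]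
  by (auto intro!: vderiv_eqI)

lemma vderiv_of_real:
  "smooth v \<Longrightarrow> vderiv (\<lambda>x. complex_of_real (v x)) = (\<lambda>x. complex_of_real (vderiv v x))"
  using has_vector_derivative_of_real_smooth by (auto intro!: vderiv_eqI)

lemma smooth_cnj: "smooth g \<Longrightarrow> smooth (\<lambda>x. cnj (g x))"
  by (rule smooth_bounded_linear[OF bounded_linear_cnj])

lemma smooth_of_real: "smooth v \<Longrightarrow> smooth (\<lambda>x. complex_of_real (v x))"
  by (rule smooth_bounded_linear[OF bounded_linear_of_real])

lemma formal_adjoint_cnj:
  "smooth g \<Longrightarrow> formal_adjoint a b (\<lambda>x. cnj (g x)) x = cnj (formal_adjoint a b g x)"
  by (simp add: formal_adjoint_def vderiv_cnj smooth_vderiv)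

lemma continuous_on_diff_op:
  "smooth a \<Longrightarrow> smooth b \<Longrightarrow> smooth u \<Longrightarrow> continuous_on A (diff_op a b u)"
  unfolding diff_op_def[abs_def]
  by (intro continuous_intros smooth_continuous smooth_vderiv)

lemma continuous_on_formal_adjoint:
  "smooth a \<Longrightarrow> smooth b \<Longrightarrow> smooth g \<Longrightarrow> continuous_on A (formal_adjoint a b g)"
  unfolding formal_adjoint_def[abs_def]
  by (intro continuous_intros smooth_continuous smooth_vderiv)

lemma diff_op_vanish:
  assumes "\<And>x. R < \<bar>x\<bar> \<Longrightarrow> u x = 0" "R < \<bar>x\<bar>"
  shows "diff_op a b u x = 0"
  using assms vderiv_vanish[of R u] vderiv_vanish[of R "vderiv u"] by (simp add: diff_op_def)

lemma formal_adjoint_vanish: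
  assumes "\<And>x. R < \<bar>x\<bar> \<Longrightarrow> u x = 0" "R < \<bar>x\<bar>"
  shows "formal_adjoint a b u x = 0"
  using assms vderiv_vanish[of R u] vderiv_vanish[of R "vderiv u"] by (simp add: formal_adjoint_def)

lemma diff_op_square_integrable:
  assumes "smooth a" "smooth b" "u \<in> C_inf_comp"
  shows "square_integrable (diff_op a b u)"
proof -
  obtain R where "\<forall>x. R < \<bar>x\<bar> \<longrightarrow> u x = 0"
    by (rule C_inf_comp_vanish[OF assms(3)])
  note R = this[rule_format]
  show ?thesis
    by (rule continuous_compact_support_square_integrable[OF continuous_on_diff_op diff_op_vanish[of R u, OF R]])
      (use assms C_inf_comp_smooth in auto)
qed

lemma formal_adjoint_square_integrable:
  assumes "smooth a" "smooth b" "u \<in> C_inf_comp"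
  shows "square_integrable (formal_adjoint a b u)"
proof -
  obtain R where "\<forall>x. R < \<bar>x\<bar> \<longrightarrow> u x = 0"
    by (rule C_inf_comp_vanish[OF assms(3)])
  note R = this[rule_format]
  show ?thesis
    by (rule continuous_compact_support_square_integrable[OF continuous_on_formal_adjoint formal_adjoint_vanish[of R u, OF R]])
      (use assms C_inf_comp_smooth in auto)
qed

text \<open>
  The difference \<open>(Lu) g - u (L\<^sup>+ g)\<close> is the derivative of the boundary form
  \<open>W = - u' g + u g' + a u g\<close>, which has compact support whatever \<open>g\<close> does at infinity. The pairing
  is bilinear here; the sesquilinear version follows by conjugating \<open>g\<close>, because \<open>a\<close> and \<open>b\<close> are
  real.
\<close>

lemma integral_Lagrange_identity:
  assumes a: "smooth a" and b: "smooth b" and u: "u \<in> C_inf_comp" and g: "smooth g"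
  shows "(\<integral>x. diff_op a b u x * g x \<partial>lborel) = (\<integral>x. u x * formal_adjoint a b g x \<partial>lborel)"
proof -
  note us = C_inf_comp_smooth[OF u]
  obtain R where "\<forall>x. R < \<bar>x\<bar> \<longrightarrow> u x = 0"
    by (rule C_inf_comp_vanish[OF u])
  note R = this[rule_format]
  have cont: "continuous_on UNIV (\<lambda>x. diff_op a b u x * g x)"
    "continuous_on UNIV (\<lambda>x. u x * formal_adjoint a b g x)"
    by (intro continuous_intros smooth_continuous continuous_on_diff_op
        continuous_on_formal_adjoint a b us g)+
  have int: "integrable lborel (\<lambda>x. diff_op a b u x * g x)"
    "integrable lborel (\<lambda>x. u x * formal_adjoint a b g x)"
    by (rule continuous_compact_support_integrable[OF cont(1), of R];
        simp add: diff_op_vanish[OF R])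
      (rule continuous_compact_support_integrable[OF cont(2), of R]; simp add: R)
  define W where "W x = - (vderiv u x * g x) + u x * vderiv g x + complex_of_real (a x) * (u x * g x)"
    for x
  have dW: "(W has_vector_derivative diff_op a b u x * g x - u x * formal_adjoint a b g x) (at x)" for x
    unfolding W_def[abs_def] diff_op_def formal_adjoint_def
    by (rule has_vector_derivative_eq_rhs, (rule has_vector_derivative_add has_vector_derivative_minus
        has_vector_derivative_mult has_vector_derivative_of_real_smooth smooth_has_vderiv
        smooth_vderiv a us g)+) (simp add: algebra_simps)
  have "W x = 0" if "R < \<bar>x\<bar>" for x
    using that vderiv_vanish[of R u, OF R] by (simp add: W_def R)
  from integral_deriv_compact_support(2)[OF dW continuous_on_diff[OF cont] this]
  have "(\<integral>x. diff_op a b u x * g x - u x * formal_adjoint a b g x \<partial>lborel) = 0" .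
  then show ?thesis
    using int by simp
qed

lemma formal_adjoint_in_adjoint:
  assumes "smooth a" "smooth b" "smooth g"
    and "square_integrable g" "square_integrable (formal_adjoint a b g)"
  shows "(to_L2 g, to_L2 (formal_adjoint a b g)) \<in> adjoint_operator (L00 a b)"
  using assms
  by (auto simp: adjoint_operator_def L00_def to_L2_simps C_inf_comp_square_integrable
      diff_op_square_integrable integral_Lagrange_identity smooth_cnj formal_adjoint_cnj)

lemma dense_adjoint_domain:
  assumes "smooth a" "smooth b"
  shows "closure (Domain (adjoint_operator (L00 a b))) = UNIV"
proof -
  have "to_L2 ` C_inf_comp \<subseteq> Domain (adjoint_operator (L00 a b))"
    using formal_adjoint_in_adjoint[OF assms] C_inf_comp_smooth C_inf_comp_square_integrable
      formal_adjoint_square_integrable[OF assms] by blast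
  from closure_mono[OF this] show ?thesis
    by (simp add: C_inf_comp_dense top.extremum_unique)
qed

lemma linear_operator_L00:
  assumes "smooth a" "smooth b"
  shows "linear_operator (L00 a b)"
  unfolding linear_operator_def
proof (intro conjI allI ballI, safe)
  show "single_valued (L00 a b)"
    by (rule single_valued_dense_adjoint[OF dense_adjoint_domain[OF assms]])
  have scale: "(c *\<^sub>C x, c *\<^sub>C y) \<in> L00 a b" if xy: "(x, y) \<in> L00 a b" for c x y
  proof -
    obtain u where u: "u \<in> C_inf_comp" "x = to_L2 u" "y = to_L2 (diff_op a b u)"
      using xy by (auto simp: L00_def)
    have d: "vderiv (\<lambda>x. c * w x) = (\<lambda>x. c * vderiv w x)" if "smooth w" for w
      using bounded_linear.has_vector_derivative[OF bounded_linear_mult_right smooth_has_vderiv[OF that]]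
      by (auto intro!: vderiv_eqI)
    have "diff_op a b (\<lambda>x. c * u x) = (\<lambda>x. c * diff_op a b u x)"
      using C_inf_comp_smooth[OF u(1)]
      by (auto simp: diff_op_def d smooth_vderiv algebra_simps)
    moreover have "(\<lambda>x. c * u x) \<in> C_inf_comp"
      by (rule C_inf_comp_mult[OF u(1)])
    ultimately show ?thesis
      using u assms unfolding L00_def
      by (auto simp: to_L2_simps C_inf_comp_square_integrable diff_op_square_integrable
          intro!: exI[of _ "\<lambda>x. c * u x"])
  qed
  then show "(x, y) \<in> L00 a b \<Longrightarrow> (c *\<^sub>C x, c *\<^sub>C y) \<in> L00 a b" for c x y .
  have "(\<lambda>x. 0) \<in> C_inf_comp"
    by (rule C_inf_compI[OF smooth_const]) simp
  then obtain x y where "(x, y) \<in> L00 a b"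
    by (auto simp: L00_def)
  moreover have "0 *\<^sub>C z = 0" for z
    using norm_scaleC[of 0 z] by simp
  ultimately show "0 \<in> L00 a b"
    using scale[of x y 0] by (simp add: zero_prod_def)
  fix x y x' y' assume "(x, y) \<in> L00 a b" "(x', y') \<in> L00 a b"
  then obtain u w where u: "u \<in> C_inf_comp" "x = to_L2 u" "y = to_L2 (diff_op a b u)"
    and w: "w \<in> C_inf_comp" "x' = to_L2 w" "y' = to_L2 (diff_op a b w)"
    by (auto simp: L00_def)
  have d: "vderiv (\<lambda>x. f x + g x) = (\<lambda>x. vderiv f x + vderiv g x)"
    if "smooth f" "smooth g" for f g :: "real \<Rightarrow> complex"
    using that by (auto intro!: vderiv_eqI has_vector_derivative_add smooth_has_vderiv)
  have "diff_op a b (\<lambda>x. u x + w x) = (\<lambda>x. diff_op a b u x + diff_op a b w x)"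
    using C_inf_comp_smooth[OF u(1)] C_inf_comp_smooth[OF w(1)]
    by (auto simp: diff_op_def d smooth_vderiv algebra_simps)
  moreover have "(\<lambda>x. u x + w x) \<in> C_inf_comp"
    by (rule C_inf_comp_add[OF u(1) w(1)])
  ultimately show "(x + x', y + y') \<in> L00 a b"
    using u w assms unfolding L00_def
    by (auto simp: to_L2_simps C_inf_comp_square_integrable diff_op_square_integrable
        intro!: exI[of _ "\<lambda>x. u x + w x"])
qed

text \<open>
  When \<open>b = a'/2\<close>, the function \<open>Re ((Lu) cnj u) - \<bar>u'\<bar>\<^sup>2\<close> is the derivative of
  \<open>W = - Re (u' cnj u) + a \<bar>u\<bar>\<^sup>2 / 2\<close>, so the real part of \<open>(Lu, u)\<close> is the integral of
  \<open>\<bar>u'\<bar>\<^sup>2\<close>.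
\<close>

lemma accretive_L00:
  assumes a: "smooth a" and b: "smooth b" and half: "\<And>x. b x = vderiv a x / 2"
  shows "accretive (L00 a b)"
  unfolding accretive_def
proof (intro conjI linear_operator_L00 a b, safe)
  fix x y assume "(x, y) \<in> L00 a b"
  then obtain u where u: "u \<in> C_inf_comp" and xy: "x = to_L2 u" "y = to_L2 (diff_op a b u)"
    by (auto simp: L00_def)
  note us = C_inf_comp_smooth[OF u]
  obtain R where "\<forall>x. R < \<bar>x\<bar> \<longrightarrow> u x = 0"
    by (rule C_inf_comp_vanish[OF u])
  note R = this[rule_format]
  define W where "W x = - Re (vderiv u x * cnj (u x)) + a x / 2 * Re (u x * cnj (u x))" for x
  define f where "f x = Re (diff_op a b u x * cnj (u x))" for x
  define k where "k x = (cmod (vderiv u x))\<^sup>2" for x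
  have d: "((\<lambda>x. Re (f x * cnj (g x))) has_real_derivative
      Re (f x * cnj (vderiv g x) + vderiv f x * cnj (g x))) (at x)"
    if "smooth f" "smooth g" for f g x
    unfolding has_real_derivative_iff_has_vector_derivative
    by (intro bounded_linear.has_vector_derivative[OF bounded_linear_Re] has_vector_derivative_mult
        bounded_linear.has_vector_derivative[OF bounded_linear_cnj] smooth_has_vderiv that)
  have da: "(a has_real_derivative vderiv a x) (at x)" for x
    using smooth_has_vderiv[OF a] by (simp add: has_real_derivative_iff_has_vector_derivative)
  have "(W has_real_derivative f x - k x) (at x)" for x
    unfolding W_def[abs_def] f_def k_def cmod_power2
    by (rule DERIV_cong[OF DERIV_add[OF DERIV_minus[OF d] DERIV_mult[OF DERIV_cdivide[OF da] d]]])
      (use us in \<open>simp_all add: smooth_vderiv diff_op_def half power2_eq_square field_simps\<close>)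
  then have W: "(W has_vector_derivative f x - k x) (at x)" for x
    by (simp add: has_real_derivative_iff_has_vector_derivative)
  have cont: "continuous_on UNIV f" "continuous_on UNIV k"
    unfolding f_def[abs_def] k_def[abs_def]
    by (intro continuous_intros smooth_continuous continuous_on_diff_op smooth_vderiv a b us)+
  have "W x = 0" if "R < \<bar>x\<bar>" for x
    using that by (simp add: W_def R)
  from integral_deriv_compact_support(2)[OF W continuous_on_diff[OF cont] this]
  have "(\<integral>x. f x - k x \<partial>lborel) = 0" .
  moreover have "integrable lborel f" "integrable lborel k"
    by (rule continuous_compact_support_integrable[OF cont(1), of R]; simp add: f_def R)
      (rule continuous_compact_support_integrable[OF cont(2), of R]; simp add: k_def vderiv_vanish[OF R])
  ultimately have "(\<integral>x. f x \<partial>lborel) = (\<integral>x. k x \<partial>lborel)"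
    by simp
  also have "\<dots> \<ge> 0"
    by (simp add: k_def)
  finally have "0 \<le> (\<integral>x. f x \<partial>lborel)" .
  moreover have "square_integrable u" "square_integrable (diff_op a b u)"
    using u a b by (auto intro: C_inf_comp_square_integrable diff_op_square_integrable)
  then have "(\<integral>x. f x \<partial>lborel) = Re (cinner y x)"
    unfolding f_def by (simp only: xy to_L2_simps integral_Re square_integrable_mult_cnj)
  ultimately show "0 \<le> Re (cinner y x)" by simp
qed

lemma densely_defined_L0:
  "densely_defined (L0 a b)"
proof -
  have "to_L2 ` C_inf_comp \<subseteq> Domain (L0 a b)"
    unfolding L0_def using closure_subset[of "L00 a b"] by (auto simp: L00_def)
  from closure_mono[OF this] show ?thesis
    by (simp add: C_inf_comp_dense densely_defined_def top.extremum_unique)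
qed

theorem theoremA3:
  fixes v :: "real \<Rightarrow> real"
  assumes "smooth v"
    and "\<And>x. v x > 0"
    and "square_integrable (\<lambda>x. complex_of_real (v x))"
  shows "\<exists>a b :: real \<Rightarrow> real. smooth a \<and> smooth b \<and>
    accretive (L00 a b) \<and> accretive (L0 a b) \<and>
    \<not> m_accretive (L0 a b) \<and>
    densely_defined (L0 a b) \<and>
    (to_L2 (\<lambda>x. complex_of_real (v x)), - to_L2 (\<lambda>x. complex_of_real (v x)))
      \<in> adjoint_operator (L0 a b)"
proof -
  let ?V = "\<lambda>x. complex_of_real (v x)"
  define f where "f x = v x * v x - v x * vderiv (vderiv v) x" for x
  have f: "smooth f"
    unfolding f_def[abs_def] by (intro smooth_diff smooth_mult smooth_vderiv assms)
  have "\<exists>G. \<forall>x. - \<infinity> < ereal x \<longrightarrow> ereal x < \<infinity> \<longrightarrow> (G has_vector_derivative f x) (at x)"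
    by (rule einterval_antiderivative)
      (auto intro: has_vector_derivative_continuous smooth_has_vderiv[OF f])
  then obtain G where G: "\<And>x. (G has_vector_derivative f x) (at x)"
    by auto
  define a where "a x = 2 * G x / v x ^ 2" for x
  define b where "b x = 1 / 2 * vderiv a x" for x
  have nz: "v x \<noteq> 0" for x using assms(2)[of x] by simp
  have a: "smooth a"
    unfolding a_def[abs_def]
    by (intro smooth_divide_power smooth_mult smooth_const smooth_antiderivative[OF G f] assms nz)
  have b: "smooth b"
    unfolding b_def[abs_def] by (intro smooth_mult smooth_const smooth_vderiv a)
  have acc: "accretive (L00 a b)"
    by (rule accretive_L00[OF a b]) (simp add: b_def)
  \<comment> \<open>The equation \<open>(a v\<^sup>2)' = 2 (v\<^sup>2 - v v'')\<close> divided by \<open>v\<close>.\<close>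
  have key: "vderiv a x * v x + 2 * a x * vderiv v x = 2 * (v x - vderiv (vderiv v) x)" for x
  proof -
    have "(v has_real_derivative vderiv v x) (at x)" "(a has_real_derivative vderiv a x) (at x)"
      using smooth_has_vderiv[OF assms(1)] smooth_has_vderiv[OF a]
      by (auto simp: has_real_derivative_iff_has_vector_derivative)
    then have "((\<lambda>x. a x * v x ^ 2) has_real_derivative
        v x * (vderiv a x * v x + 2 * a x * vderiv v x)) (at x)"
      by (auto intro!: derivative_eq_intros simp: algebra_simps power2_eq_square)
    moreover have "(\<lambda>x. a x * v x ^ 2) = (\<lambda>x. 2 * G x)"
      using nz by (simp add: a_def)
    moreover have "((\<lambda>x. 2 * G x) has_real_derivative 2 * f x) (at x)"
      using G[of x] unfolding has_real_derivative_iff_has_vector_derivative[symmetric]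
      by (rule DERIV_cmult)
    ultimately have "v x * (vderiv a x * v x + 2 * a x * vderiv v x) = 2 * f x"
      using DERIV_unique by metis
    also have "\<dots> = v x * (2 * (v x - vderiv (vderiv v) x))"
      by (simp add: f_def algebra_simps)
    finally show ?thesis using nz[of x] by simp
  qed
  have "- vderiv (vderiv v) x - (a x * vderiv v x + vderiv a x * v x) + b x * v x = - v x" for x
    using key[of x] by (simp add: b_def field_simps)
  then have fa: "formal_adjoint a b ?V = (\<lambda>x. - ?V x)"
    by (auto simp: formal_adjoint_def vderiv_of_real assms(1) smooth_vderiv
        simp flip: of_real_mult of_real_add of_real_diff of_real_minus)
  have "(to_L2 ?V, - to_L2 ?V) \<in> adjoint_operator (L00 a b)"
    using formal_adjoint_in_adjoint[OF a b smooth_of_real[OF assms(1)] assms(3)] assms(3)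
    by (simp add: fa to_L2_simps square_integrable_uminus)
  then have adj: "(to_L2 ?V, - to_L2 ?V) \<in> adjoint_operator (L0 a b)"
    unfolding L0_def by (rule adjoint_closure)
  have "to_L2 ?V \<noteq> 0"
  proof
    assume "to_L2 ?V = 0"
    then have "(\<integral>x. (cmod (?V x))\<^sup>2 \<partial>lborel) = 0"
      using norm_to_L2[OF assms(3)] by simp
    then have "AE x in lborel. (cmod (?V x))\<^sup>2 = 0"
      using assms(3) by (subst (asm) integral_nonneg_eq_0_iff_AE) (auto simp: square_integrable_def)
    then have "AE x in (lborel :: real measure). False"
      using nz by simp
    then show False
      by (simp add: AE_iff_null null_sets_def)
  qed
  then have "\<not> m_accretive (L0 a b)"
    by (rule not_m_accretive_adjoint_eigenvector[OF adj])
  moreover have "accretive (L0 a b)"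
    unfolding L0_def by (rule accretive_closure[OF acc dense_adjoint_domain[OF a b]])
  ultimately show ?thesis
    using a b acc adj densely_defined_L0 by blast
qed

end
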